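(* Let $\mathcal{H}$ be a real Hilbert space, $A:\mathcal{H}\to\mathcal{H}$ a single-valued operator and $B:\mathcal{H}\rightrightarrows\mathcal{H}$ a set-valued operator such that the solution set $S:=\{x\in\mathcal{H}: 0\in A(x)+B(x)\}$ is nonempty. Let $v:\mathcal{H}\to\mathcal{H}$ be a linear mapping such that the pairs $(A,v)$ and $(B,v)$ are monotone, and let $\gamma>0$ be such that $$\operatorname{ran}A\subset\operatorname{ran}v\subset\operatorname{ran}(\gamma B+v).$$ Suppose that the pair $(A,v)$ is $L$-Lipschitz continuous for some $L>0$ satisfying $\gamma<\frac1L$. Let $(x_k)_{k\ge0}$ and $(y_k)_{k\ge 0}$ be any sequences with $x_0\in\mathcal{H}$ and, for all $k\ge 0$, $$y_k\in(\gamma B+v)^{-1}\bigl(v(x_k)-\gamma Ax_k\bigr),\qquad x_{k+1}\in y_k+\gamma v^{-1}(Ax_k-Ay_k).$$ Then the following assertions hold: 1. $\|v(y_k)-v(x_k)\|\to 0$ as $k\to\infty$. 2. If $y^*$ is a weak cluster point of $(y_k)$ and the graph of $A+B$ is sequentially weak-to-strong closed, then $y^*\in S$. Moreover, if (in addition to the graph of $A+B$ being sequentially weak-to-strong closed) $v^{-1}:\operatorname{ran}v\to\mathcal{H}$ is (single-valued and) Lipschitz continuous, then $(x_k)$ converges weakly to a point in $S$. 3. If $(A+B)^{-1}$ is $R$-continuous at $0$, then $d(y_k,S)\to 0$.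
   Context: For a set-valued operator $F:\mathcal{H}\rightrightarrows\mathcal{H}$: $\operatorname{dom}F=\{x: F(x)\ne\varnothing\}$, $\operatorname{ran}F=\bigcup_{x\in\mathcal{H}}F(x)$ and $F^{-1}(y)=\{x\in\mathcal{H}: y\in F(x)\}$; in particular $v^{-1}$ is in general set-valued. A single-valued map is identified with the set-valued operator taking singleton values. A pair $(F_1,F_2)$ of operators $F_1,F_2:\mathcal{H}\rightrightarrows\mathcal{H}$ is monotone if $\langle x_1^*-y_1^*,x_2^*-y_2^*\rangle\ge 0$ for all $x,y\in\mathcal{H}$, $x_1^*\in F_1(x)$, $y_1^*\in F_1(y)$, $x_2^*\in F_2(x)$, $y_2^*\in F_2(y)$. The pair $(A,v)$ is $L$-Lipschitz continuous if $\|Ax-Ay\|\le L\|v(x)-v(y)\|$ for all $x,y\in\mathcal{H}$. A weak cluster point of a sequence is the weak limit of a subsequence. The graph of $F:\mathcal{H}\rightrightarrows\mathcal{H}$ is sequentially weak-to-strong closed if, for any sequences $x_k\rightharpoonup x$ (weakly) and $y_k\in F(x_k)$ with $y_k\to y$ (in norm), one has $y\in F(x)$. $F:\mathcal{H}\rightrightarrows\mathcal{H}$ is $R$-continuous at $\bar x\in\operatorname{dom}F$ if there exist $\sigma>0$ and a nondecreasing function $\rho:[0,\infty)\to[0,\infty)$ with $\lim_{r\to0^+}\rho(r)=\rho(0)=0$ such that for every $x$ in the ball of center $\bar x$ and radius $\sigma$ and every $y\in F(x)$ there exists $\bar y\in F(\bar x)$ with $\|y-\bar y\|\le\rho(\|x-\bar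 x\|)$. $d(y,S)=\inf_{s\in S}\|y-s\|$. *)

theory Defs
  imports "HOL-Analysis.Analysis"
begin

text \<open>
  A set-valued operator from a space \<open>'a\<close> to itself is a function \<open>'a \<Rightarrow> 'a set\<close>.  The sum of two
  such operators is the pointwise Minkowski sum, for which we use the library's addition of sets.
\<close>

definition single_op :: "('a \<Rightarrow> 'b) \<Rightarrow> 'a \<Rightarrow> 'b set" where
  "single_op f = (\<lambda>x. {f x})"

definition dom_op :: "('a \<Rightarrow> 'b set) \<Rightarrow> 'a set" where
  "dom_op F = {x. F x \<noteq> {}}"

definition ran_op :: "('a \<Rightarrow> 'b set) \<Rightarrow> 'b set" where
  "ran_op F = (\<Union>x. F x)"

definition inv_op :: "('a \<Rightarrow> 'b set) \<Rightarrow> 'b \<Rightarrow> 'a set" where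
  "inv_op F y = {x. y \<in> F x}"

definition sum_op :: "('a \<Rightarrow> 'b::real_vector set) \<Rightarrow> ('a \<Rightarrow> 'b set) \<Rightarrow> 'a \<Rightarrow> 'b set" where
  "sum_op F G = (\<lambda>x. F x + G x)"

definition scale_op :: "real \<Rightarrow> ('a \<Rightarrow> 'b::real_vector set) \<Rightarrow> 'a \<Rightarrow> 'b set" where
  "scale_op c F = (\<lambda>x. (*\<^sub>R) c ` F x)"

definition monotone_pair :: "('a::real_inner \<Rightarrow> 'a set) \<Rightarrow> ('a \<Rightarrow> 'a set) \<Rightarrow> bool" where
  "monotone_pair F1 F2 \<longleftrightarrow>
     (\<forall>x y. \<forall>x1 \<in> F1 x. \<forall>y1 \<in> F1 y. \<forall>x2 \<in> F2 x. \<forall>y2 \<in> F2 y. inner (x1 - y1) (x2 - y2) \<ge> 0)"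

definition lipschitz_pair :: "real \<Rightarrow> ('a::real_inner \<Rightarrow> 'a) \<Rightarrow> ('a \<Rightarrow> 'a) \<Rightarrow> bool" where
  "lipschitz_pair L A v \<longleftrightarrow> (\<forall>x y. norm (A x - A y) \<le> L * norm (v x - v y))"

text \<open>
  Weak convergence in a Hilbert space: continuous linear functionals are represented by inner
  products.
\<close>

definition weakly_tendsto :: "(nat \<Rightarrow> 'a::real_inner) \<Rightarrow> 'a \<Rightarrow> bool" where
  "weakly_tendsto X l \<longleftrightarrow> (\<forall>u. (\<lambda>n. inner (X n) u) \<longlonglongrightarrow> inner l u)"

definition weak_cluster_point :: "(nat \<Rightarrow> 'a::real_inner) \<Rightarrow> 'a \<Rightarrow> bool" where
  "weak_cluster_point X l \<longleftrightarrow> (\<exists>r. strict_mono r \<and> weakly_tendsto (X \<circ> r) l)"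

definition weak_strong_seq_closed :: "('a::real_inner \<Rightarrow> 'a set) \<Rightarrow> bool" where
  "weak_strong_seq_closed F \<longleftrightarrow>
     (\<forall>X Y x y. weakly_tendsto X x \<longrightarrow> (\<forall>k. Y k \<in> F (X k)) \<longrightarrow> Y \<longlonglongrightarrow> y \<longrightarrow> y \<in> F x)"

text \<open>
  The modulus \<open>\<rho>\<close> is a function on the nonnegative reals, so it is constrained only there.
\<close>

definition R_continuous_at :: "('a::real_inner \<Rightarrow> 'a set) \<Rightarrow> 'a \<Rightarrow> bool" where
  "R_continuous_at F xb \<longleftrightarrow>
     xb \<in> dom_op F \<and>
     (\<exists>\<sigma> > 0. \<exists>\<rho> :: real \<Rightarrow> real.
        mono_on {0..} \<rho> \<and> (\<forall>r \<ge> 0. \<rho> r \<ge> 0) \<and> (\<rho> \<longlongrightarrow> 0) (at_right 0) \<and> \<rho> 0 = 0 \<and>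
        (\<forall>x \<in> cball xb \<sigma>. \<forall>y \<in> F x. \<exists>yb \<in> F xb. norm (y - yb) \<le> \<rho> (norm (x - xb))))"

text \<open>
  \<open>v\<inverse>\<close>, a priori set-valued, is single-valued on the range of \<open>v\<close> and Lipschitz continuous there.
\<close>

definition lipschitz_inverse :: "('a::real_inner \<Rightarrow> 'a) \<Rightarrow> bool" where
  "lipschitz_inverse v \<longleftrightarrow>
     (\<exists>w C. (\<forall>z \<in> range v. inv_op (single_op v) z = {w z}) \<and> C-lipschitz_on (range v) w)"

end

theory Submission
  imports Defs
begin

text \<open>
  Write \<open>u\<^sub>k = v x\<^sub>k\<close> and \<open>q\<^sub>k = v y\<^sub>k\<close>.  In these variables the iteration is Tseng's
  forward-backward-forward method for \<open>A \<circ> v\<inverse>\<close> and \<open>B \<circ> v\<inverse>\<close> on the range of \<open>v\<close>: for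
  \<open>t = v s\<close> with \<open>s\<close> a solution, \<open>\<parallel>u\<^sub>k\<^sub>+\<^sub>1 - t\<parallel>\<^sup>2 \<le> \<parallel>u\<^sub>k - t\<parallel>\<^sup>2 - (1 - \<gamma>\<^sup>2L\<^sup>2) \<parallel>q\<^sub>k - u\<^sub>k\<parallel>\<^sup>2\<close>, so \<open>q\<^sub>k - u\<^sub>k \<rightarrow> 0\<close>, and
  \<open>(u\<^sub>k - u\<^sub>k\<^sub>+\<^sub>1) / \<gamma> \<in> (A + B) y\<^sub>k\<close> tends to \<open>0\<close>.

  Since \<open>v\<close> may be unbounded, even when its inverse is Lipschitz, the weak limit of \<open>u\<^sub>k\<close> may lie outside
  the range of \<open>v\<close>.  The resolvent of \<open>\<gamma>B \<circ> v\<inverse>\<close> and the map \<open>A \<circ> v\<inverse>\<close> are therefore extended by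
  uniform continuity to the closure of the range, where the resolvent of the sum is a nonexpansive map
  \<open>T\<close> with \<open>u\<^sub>k - T u\<^sub>k \<rightarrow> 0\<close>.  Weak sequential compactness is avoided: the asymptotic centers of all
  subsequences of \<open>u\<^sub>k\<close> are fixed points of \<open>T\<close>, hence by Fejer monotonicity they coincide, and their
  common value is the weak limit.
\<close>

section \<open>Asymptotic centers of bounded sequences\<close>

text \<open>Here \<open>m\<close> is the least value over \<open>U\<close> of the limit superior of
  \<open>norm (u k - z)\<close>, expressed through eventual bounds, and \<open>z\<close> is its
  minimizer. The parallelogram law forces near-minimizers to be close to each other, so completeness
  gives existence and the same estimate gives uniqueness.\<close>

lemma asymptotic_center:
  fixes u :: "nat \<Rightarrow> 'a::{real_inner, complete_space}"
  assumes U: "closed U" "convex U" "U \<noteq> {}" and bdd: "bounded (range u)"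
  obtains m z where "0 \<le> m" "z \<in> U"
    "\<forall>R>m. \<forall>\<^sub>F k in sequentially. norm (u k - z) \<le> R"
    "\<forall>z'\<in>U. \<forall>R. (\<forall>\<^sub>F k in sequentially. norm (u k - z') \<le> R) \<longrightarrow> m \<le> R"
    "\<forall>z'\<in>U. (\<forall>R>m. \<forall>\<^sub>F k in sequentially. norm (u k - z') \<le> R) \<longrightarrow> z' = z"
proof -
  define E where "E = {R. \<exists>z\<in>U. \<forall>\<^sub>F k in sequentially. norm (u k - z) \<le> R}"
  define m where "m = Inf E"
  have E_ge: "0 \<le> R" if "R \<in> E" for R
  proof -
    from that obtain z where "\<forall>\<^sub>F k in sequentially. norm (u k - z) \<le> R"
      by (auto simp: E_def)
    then obtain k where "norm (u k - z) \<le> R"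
      by (auto simp: eventually_sequentially)
    then show ?thesis
      by (meson norm_ge_zero order_trans)
  qed
  have E_ne: "E \<noteq> {}"
  proof -
    obtain z where "z \<in> U" using U by blast
    obtain K where K: "\<And>k. norm (u k) \<le> K"
      using bdd by (auto simp: bounded_iff)
    have "norm (u k - z) \<le> K + norm z" for k
      using norm_triangle_ineq4[of "u k" z] K[of k] by linarith
    with \<open>z \<in> U\<close> have "K + norm z \<in> E" unfolding E_def by (auto intro!: always_eventually bexI[of _ z])
    then show ?thesis by blast
  qed
  have bb: "bdd_below E" using E_ge by (rule bdd_belowI)
  have m0: "0 \<le> m" unfolding m_def using E_ne E_ge by (rule cInf_greatest)
  have m_le: "m \<le> R" if "z \<in> U" "\<forall>\<^sub>F k in sequentially. norm (u k - z) \<le> R" for z R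
    unfolding m_def by (rule cInf_lower[OF _ bb]) (use that in \<open>auto simp: E_def\<close>)
  \<comment> \<open>The midpoint of \<open>z1\<close> and \<open>z2\<close> lies in \<open>U\<close>
    and has the eventual bound \<open>sqrt (R\<^sup>2 - (norm (z1 - z2))\<^sup>2 / 4)\<close>, which
    cannot be below \<open>m\<close>.\<close>
  have key: "(norm (z1 - z2))\<^sup>2 \<le> 4 * (R\<^sup>2 - m\<^sup>2)"
    if z: "z1 \<in> U" "z2 \<in> U" and ev: "\<forall>\<^sub>F k in sequentially. norm (u k - z1) \<le> R"
      "\<forall>\<^sub>F k in sequentially. norm (u k - z2) \<le> R" for z1 z2 R
  proof -
    define c where "c = (1/2) *\<^sub>R z1 + (1/2) *\<^sub>R z2"
    have "c \<in> U" unfolding c_def using z U(2) by (intro convexD) auto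
    moreover have "\<forall>\<^sub>F k in sequentially. norm (u k - c) \<le> sqrt (R\<^sup>2 - (norm (z1 - z2))\<^sup>2 / 4)"
      using ev
    proof eventually_elim
      case (elim k)
      have "(norm (u k - c))\<^sup>2 =
          (norm (u k - z1))\<^sup>2 / 2 + (norm (u k - z2))\<^sup>2 / 2 - (norm (z1 - z2))\<^sup>2 / 4"
        unfolding c_def power2_norm_eq_inner
        by (simp add: inner_diff_left inner_diff_right inner_add_left inner_add_right
            inner_commute field_simps)
      moreover have "(norm (u k - z1))\<^sup>2 \<le> R\<^sup>2" "(norm (u k - z2))\<^sup>2 \<le> R\<^sup>2"
        using elim by (auto intro: power_mono)
      ultimately show ?case by (intro real_le_rsqrt) linarith
    qed
    ultimately have le: "m \<le> sqrt (R\<^sup>2 - (norm (z1 - z2))\<^sup>2 / 4)" by (rule m_le)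
    with m0 have "0 \<le> R\<^sup>2 - (norm (z1 - z2))\<^sup>2 / 4"
      by (meson order_trans real_sqrt_ge_0_iff)
    with le m0 have "m\<^sup>2 \<le> R\<^sup>2 - (norm (z1 - z2))\<^sup>2 / 4"
      by (metis power_mono real_sqrt_pow2)
    then show ?thesis by simp
  qed
  have uniq: "z1 = z2"
    if z: "z1 \<in> U" "z2 \<in> U"
      and ev: "\<And>R. m < R \<Longrightarrow> \<forall>\<^sub>F k in sequentially. norm (u k - z1) \<le> R"
      "\<And>R. m < R \<Longrightarrow> \<forall>\<^sub>F k in sequentially. norm (u k - z2) \<le> R" for z1 z2
  proof -
    have "((\<lambda>R. 4 * (R\<^sup>2 - m\<^sup>2)) \<longlongrightarrow> 4 * (m\<^sup>2 - m\<^sup>2)) (at_right m)"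
      by (intro tendsto_intros)
    moreover have "\<forall>\<^sub>F R in at_right m. (norm (z1 - z2))\<^sup>2 \<le> 4 * (R\<^sup>2 - m\<^sup>2)"
      using eventually_at_right_less by eventually_elim (use z ev key in auto)
    ultimately have "(norm (z1 - z2))\<^sup>2 \<le> 4 * (m\<^sup>2 - m\<^sup>2)"
      by (intro tendsto_lowerbound) auto
    then show ?thesis by simp
  qed
  \<comment> \<open>A minimizing sequence \<open>Z\<close> with errors \<open>\<epsilon> n\<close>
    is chosen; \<open>key\<close> at the common radius \<open>m + \<epsilon> N\<close> shows that it
    is Cauchy.\<close>
  define \<epsilon> where "\<epsilon> n = inverse (real (Suc n))" for n
  have \<epsilon>: "\<epsilon> \<longlonglongrightarrow> 0" unfolding \<epsilon>_def by (rule LIMSEQ_inverse_real_of_nat)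
  have "\<exists>z\<in>U. \<forall>\<^sub>F k in sequentially. norm (u k - z) \<le> m + \<epsilon> n" for n
  proof -
    have "Inf E < m + \<epsilon> n" by (simp add: m_def \<epsilon>_def)
    then obtain R z where R: "R < m + \<epsilon> n" "z \<in> U" "\<forall>\<^sub>F k in sequentially. norm (u k - z) \<le> R"
      using cInf_less_iff[OF E_ne bb] by (auto simp: E_def)
    from R(3) have "\<forall>\<^sub>F k in sequentially. norm (u k - z) \<le> m + \<epsilon> n"
      by eventually_elim (use R(1) in linarith)
    with R(2) show ?thesis by blast
  qed
  then obtain Z where Z: "\<And>n. Z n \<in> U"
      "\<And>n. \<forall>\<^sub>F k in sequentially. norm (u k - Z n) \<le> m + \<epsilon> n"
    by metis
  have "Cauchy Z"
  proof (rule metric_CauchyI)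
    fix e :: real assume e: "0 < e"
    have "(\<lambda>n. 4 * ((m + \<epsilon> n)\<^sup>2 - m\<^sup>2)) \<longlonglongrightarrow> 4 * ((m + 0)\<^sup>2 - m\<^sup>2)"
      by (intro tendsto_intros \<epsilon>)
    then have "\<forall>\<^sub>F n in sequentially. 4 * ((m + \<epsilon> n)\<^sup>2 - m\<^sup>2) < e\<^sup>2"
      by (rule order_tendstoD) (use e in simp)
    then obtain N where N: "4 * ((m + \<epsilon> N)\<^sup>2 - m\<^sup>2) < e\<^sup>2"
      by (auto simp: eventually_sequentially)
    have ZN: "\<forall>\<^sub>F k in sequentially. norm (u k - Z n) \<le> m + \<epsilon> N" if "N \<le> n" for n
    proof -
      have "\<epsilon> n \<le> \<epsilon> N" using that by (simp add: \<epsilon>_def field_simps)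
      then show ?thesis using Z(2)[of n] by (auto elim: eventually_mono)
    qed
    have "dist (Z n) (Z l) < e" if "N \<le> n" "N \<le> l" for n l
    proof -
      have "(norm (Z n - Z l))\<^sup>2 < e\<^sup>2"
        using key[OF Z(1) Z(1) ZN[OF that(1)] ZN[OF that(2)]] N by linarith
      then show ?thesis using e by (simp add: dist_norm power2_less_imp_less)
    qed
    then show "\<exists>M. \<forall>n\<ge>M. \<forall>l\<ge>M. dist (Z n) (Z l) < e" by blast
  qed
  then obtain z where z: "Z \<longlonglongrightarrow> z"
    using Cauchy_convergent convergent_def by blast
  have zU: "z \<in> U" using U(1) Z(1) z by (meson closed_sequentially)
  have evz: "\<forall>\<^sub>F k in sequentially. norm (u k - z) \<le> R" if "m < R" for R
  proof -
    have "(\<lambda>n. m + \<epsilon> n + norm (Z n - z)) \<longlonglongrightarrow> m + 0 + norm (z - z)"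
      by (intro tendsto_intros \<epsilon> z)
    then have "\<forall>\<^sub>F n in sequentially. m + \<epsilon> n + norm (Z n - z) < R"
      by (rule order_tendstoD) (use that in simp)
    then obtain n where n: "m + \<epsilon> n + norm (Z n - z) < R"
      by (auto simp: eventually_sequentially)
    show ?thesis using Z(2)[of n]
    proof eventually_elim
      case (elim k)
      then show ?case using n norm_triangle_ineq[of "u k - Z n" "Z n - z"] by simp
    qed
  qed
  show ?thesis
  proof (rule that[OF m0 zU])
    show "\<forall>R>m. \<forall>\<^sub>F k in sequentially. norm (u k - z) \<le> R"
      using evz by blast
    show "\<forall>z'\<in>U. \<forall>R. (\<forall>\<^sub>F k in sequentially. norm (u k - z') \<le> R) \<longrightarrow> m \<le> R"
      using m_le by blast
    show "\<forall>z'\<in>U. (\<forall>R>m. \<forall>\<^sub>F k in sequentially. norm (u k - z') \<le> R) \<longrightarrow> z' = z"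
    proof (intro ballI impI)
      fix z' assume "z' \<in> U" "\<forall>R>m. \<forall>\<^sub>F k in sequentially. norm (u k - z') \<le> R"
      then show "z' = z" by (intro uniq zU evz) auto
    qed
  qed
qed

text \<open>The asymptotic center of the constant sequence 0 is the projection of 0 onto
  \<open>C\<close>, and the inequality is its variational characterization.\<close>

lemma closed_convex_min_norm:
  fixes C :: "'a::{real_inner, complete_space} set"
  assumes C: "closed C" "convex C" "C \<noteq> {}"
  obtains a where "a \<in> C" "\<And>c. c \<in> C \<Longrightarrow> inner a a \<le> inner c a"
proof -
  have "bounded (range (\<lambda>_::nat. 0::'a))" by simp
  then obtain m a where a: "a \<in> C"
    and up: "\<forall>R>m. \<forall>\<^sub>F k::nat in sequentially. norm (0 - a) \<le> R"
    and low: "\<forall>c\<in>C. \<forall>R. (\<forall>\<^sub>F k::nat in sequentially. norm (0 - c) \<le> R) \<longrightarrow> m \<le> R"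
    by (rule asymptotic_center[OF C])
  have "norm a \<le> m" by (rule dense_ge) (use up in simp)
  then have min: "norm a \<le> norm c" if "c \<in> C" for c
    using low that by (force intro: order_trans)
  show ?thesis
  proof (rule that[OF a])
    fix c assume c: "c \<in> C"
    show "inner a a \<le> inner c a"
      using any_closest_point_dot[OF C(2,1) a c, of 0] min
      by (simp add: inner_diff_right inner_commute)
  qed
qed

section \<open>Weak limits of almost fixed sequences of nonexpansive maps\<close>

text \<open>The limit is the center \<open>z\<close> of the whole sequence. By Fejer monotonicity no
  subsequence has a smaller asymptotic radius. If \<open>u k - z\<close> kept a positive inner
  product with some \<open>a\<close> along a subsequence, shifting \<open>z\<close> along
  \<open>a\<close> would produce such a smaller radius.\<close>

lemma nonexpansive_weak_limit:
  fixes u :: "nat \<Rightarrow> 'a::{real_inner, complete_space}"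
  assumes U: "closed U" "subspace U"
    and T: "T ` U \<subseteq> U" and nonexp: "\<And>a b. a \<in> U \<Longrightarrow> b \<in> U \<Longrightarrow> norm (T a - T b) \<le> norm (a - b)"
    and uU: "\<And>k. u k \<in> U" and bdd: "bounded (range u)"
    and reg: "(\<lambda>k. u k - T (u k)) \<longlonglongrightarrow> 0"
    and fejer: "\<And>z. z \<in> U \<Longrightarrow> T z = z \<Longrightarrow> convergent (\<lambda>k. norm (u k - z))"
  obtains z where "z \<in> U" "T z = z" "\<And>a. a \<in> U \<Longrightarrow> (\<lambda>k. inner (u k - z) a) \<longlonglongrightarrow> 0"
proof -
  have conv: "convex U" "U \<noteq> {}"
    using subspace_imp_convex[OF U(2)] subspace_0[OF U(2)] by auto
  \<comment> \<open>The center of a subsequence is a fixed point, because \<open>T\<close> moves it no farther away.\<close>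
  have center: "\<exists>m z. 0 \<le> m \<and> z \<in> U \<and> T z = z \<and>
      (\<forall>R>m. \<forall>\<^sub>F k in sequentially. norm (u (r k) - z) \<le> R) \<and>
      (\<forall>z'\<in>U. \<forall>R. (\<forall>\<^sub>F k in sequentially. norm (u (r k) - z') \<le> R) \<longrightarrow> m \<le> R)"
    if r: "strict_mono r" for r
  proof -
    have "bounded (range (\<lambda>k. u (r k)))" by (rule bounded_subset[OF bdd]) auto
    then obtain m z
      where m: "0 \<le> m" and z: "z \<in> U"
      and up: "\<forall>R>m. \<forall>\<^sub>F k in sequentially. norm (u (r k) - z) \<le> R"
      and low: "\<forall>z'\<in>U. \<forall>R. (\<forall>\<^sub>F k in sequentially. norm (u (r k) - z') \<le> R) \<longrightarrow> m \<le> R"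
      and uniq: "\<forall>z'\<in>U. (\<forall>R>m. \<forall>\<^sub>F k in sequentially. norm (u (r k) - z') \<le> R) \<longrightarrow> z' = z"
      by (rule asymptotic_center[OF U(1) conv])
    have "T z = z"
    proof (rule uniq[rule_format])
      show "T z \<in> U" using T z by blast
      fix R assume R: "m < R"
      define e where "e = (R - m) / 2"
      have e: "0 < e" "m < R - e" using R by (auto simp: e_def field_simps)
      have "(\<lambda>k. norm (u (r k) - T (u (r k)))) \<longlonglongrightarrow> 0"
        using LIMSEQ_subseq_LIMSEQ[OF tendsto_norm_zero[OF reg] r] by (simp add: o_def)
      then have "\<forall>\<^sub>F k in sequentially. norm (u (r k) - T (u (r k))) < e"
        by (rule order_tendstoD) (use e in simp)
      with up[rule_format, OF e(2)] show "\<forall>\<^sub>F k in sequentially. norm (u (r k) - T z) \<le> R"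
      proof eventually_elim
        case (elim k)
        have "norm (u (r k) - T z) \<le> norm (u (r k) - T (u (r k))) + norm (T (u (r k)) - T z)"
          using norm_triangle_ineq[of "u (r k) - T (u (r k))" "T (u (r k)) - T z"] by simp
        then show ?case using elim nonexp[OF uU z, of "r k"] by linarith
      qed
    qed
    then show ?thesis using m z up low by blast
  qed
  obtain m z where z: "z \<in> U" "T z = z"
    and m: "0 \<le> m" and up: "\<And>R. m < R \<Longrightarrow> \<forall>\<^sub>F k in sequentially. norm (u k - z) \<le> R"
    and low: "\<And>z' R. z' \<in> U \<Longrightarrow> \<forall>\<^sub>F k in sequentially. norm (u k - z') \<le> R \<Longrightarrow> m \<le> R"
    using center[of "\<lambda>k. k"] by (auto simp: strict_mono_def)
  \<comment> \<open>The center \<open>z1\<close> of the subsequence is a fixed point, so the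
    distances to it converge along the whole sequence, to some \<open>d\<close>. Reading
    \<open>d\<close> along \<open>r\<close> gives \<open>d \<le> m1\<close>; reading it along the
    whole sequence gives \<open>m \<le> d\<close>.\<close>
  have low_sub: "m \<le> R"
    if r: "strict_mono r" and z': "z' \<in> U"
      and ev: "\<forall>\<^sub>F k in sequentially. norm (u (r k) - z') \<le> R" for r z' R
  proof -
    obtain m1 z1 where z1: "z1 \<in> U" "T z1 = z1"
      and up1: "\<And>R. m1 < R \<Longrightarrow> \<forall>\<^sub>F k in sequentially. norm (u (r k) - z1) \<le> R"
      and low1: "\<And>z' R. z' \<in> U \<Longrightarrow> \<forall>\<^sub>F k in sequentially. norm (u (r k) - z') \<le> R \<Longrightarrow> m1 \<le> R"
      using center[OF r] by blast
    obtain d where d: "(\<lambda>k. norm (u k - z1)) \<longlonglongrightarrow> d"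
      using fejer[OF z1] by (auto simp: convergent_def)
    have dr: "(\<lambda>k. norm (u (r k) - z1)) \<longlonglongrightarrow> d"
      using LIMSEQ_subseq_LIMSEQ[OF d r] by (simp add: o_def)
    have "d \<le> R'" if "m1 < R'" for R'
      using dr up1[OF that] by (rule tendsto_upperbound) simp
    then have "d \<le> m1" by (rule dense_ge)
    moreover have "m \<le> R'" if "d < R'" for R'
    proof -
      have "\<forall>\<^sub>F k in sequentially. norm (u k - z1) \<le> R'"
        using order_tendstoD(2)[OF d that] by eventually_elim simp
      then show ?thesis using low z1(1) by blast
    qed
    then have "m \<le> d" by (rule dense_ge)
    moreover have "m1 \<le> R" using low1[OF z' ev] .
    ultimately show ?thesis by linarith
  qed
  have half: "\<forall>\<^sub>F k in sequentially. inner (u k - z) a < e" if a: "a \<in> U" and e: "0 < e" for a e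
  proof (rule ccontr)
    assume "\<not> ?thesis"
    from not_eventually_sequentiallyD[OF this] obtain r :: "nat \<Rightarrow> nat"
      where r: "strict_mono r" and ge: "\<And>k. e \<le> inner (u (r k) - z) a"
      by (auto simp: not_less)
    have "a \<noteq> 0" using ge[of 0] e by auto
    \<comment> \<open>This \<open>t\<close> minimizes
      \<open>t * (t * inner a a) - 2 * (t * e)\<close>; the squared distance then drops by at least
      \<open>\<delta> = t * e\<close>.\<close>
    define t where "t = e / inner a a"
    have ia: "0 < inner a a" using \<open>a \<noteq> 0\<close> by simp
    define \<delta> where "\<delta> = e\<^sup>2 / inner a a"
    have t: "0 < t" and \<delta>: "0 < \<delta>" using ia e by (auto simp: t_def \<delta>_def)
    have "((\<lambda>R. R\<^sup>2 - \<delta>) \<longlongrightarrow> m\<^sup>2 - \<delta>) (at_right m)" by (intro tendsto_intros)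
    then have "\<forall>\<^sub>F R in at_right m. R\<^sup>2 - \<delta> < m\<^sup>2"
      by (rule order_tendstoD) (use \<delta> in simp)
    then have "\<forall>\<^sub>F R in at_right m. R\<^sup>2 - \<delta> < m\<^sup>2 \<and> m < R"
      using eventually_at_right_less by (rule eventually_conj)
    then obtain R where R: "R\<^sup>2 - \<delta> < m\<^sup>2" "m < R"
      using eventually_happens'[of "at_right m"] by force
    have "\<forall>\<^sub>F k in sequentially. norm (u (r k) - z) \<le> R"
      using eventually_subseq[OF r up[OF R(2)]] .
    then have "\<forall>\<^sub>F k in sequentially. norm (u (r k) - (z + t *\<^sub>R a)) \<le> sqrt (R\<^sup>2 - \<delta>)"
    proof eventually_elim
      case (elim k)
      have "(norm (u (r k) - (z + t *\<^sub>R a)))\<^sup>2 =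
          (norm (u (r k) - z))\<^sup>2 - 2 * (t * inner (u (r k) - z) a) + t * (t * inner a a)"
        unfolding power2_norm_eq_inner
        by (simp add: inner_diff_left inner_diff_right inner_add_left inner_add_right
            inner_commute algebra_simps)
      moreover have "t * inner a a = e" "t * e = \<delta>"
        using ia by (auto simp: t_def \<delta>_def power2_eq_square)
      moreover have "t * e \<le> t * inner (u (r k) - z) a"
        using t ge[of k] by simp
      moreover have "(norm (u (r k) - z))\<^sup>2 \<le> R\<^sup>2" using elim by (simp add: power_mono)
      ultimately have "(norm (u (r k) - (z + t *\<^sub>R a)))\<^sup>2 \<le> R\<^sup>2 - \<delta>" by simp
      then show ?case by (rule real_le_rsqrt)
    qed
    then have "m \<le> sqrt (R\<^sup>2 - \<delta>)"
      using low_sub[OF r] U(2) z(1) a by (meson subspace_add subspace_scale)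
    also have "\<dots> < sqrt (m\<^sup>2)" using R(1) by (rule real_sqrt_less_mono)
    finally show False using m by simp
  qed
  show ?thesis
  proof (rule that[OF z])
    fix a assume a: "a \<in> U"
    show "(\<lambda>k. inner (u k - z) a) \<longlonglongrightarrow> 0"
    proof (rule tendstoI)
      fix e :: real assume e: "0 < e"
      have "- a \<in> U" using U(2) a by (rule subspace_neg)
      from half[OF a e] half[OF this e]
      show "\<forall>\<^sub>F k in sequentially. dist (inner (u k - z) a) 0 < e"
        by eventually_elim (auto simp: dist_real_def)
    qed
  qed
qed

text \<open>The hypothesis bounds the square of \<open>norm (a' - b')\<close> by
  \<open>inner (a' - b') (a - b)\<close>, and Cauchy-Schwarz finishes. Being stated for points
  rather than for a map, it applies to set-valued resolvents as well.\<close>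

lemma firmly_nonexpansive_imp_nonexpansive:
  fixes a b a' b' :: "'a::real_inner"
  assumes "0 \<le> inner (a' - b') ((a - a') - (b - b'))"
  shows "norm (a' - b') \<le> norm (a - b)"
proof -
  have "(norm (a' - b'))\<^sup>2 \<le> inner (a' - b') (a - b)"
    using assms by (simp add: power2_norm_eq_inner inner_diff_left inner_diff_right algebra_simps)
  also have "\<dots> \<le> norm (a' - b') * norm (a - b)" by (rule norm_cauchy_schwarz)
  finally show ?thesis
    by (cases "a' = b'") (auto simp: power2_eq_square)
qed

section \<open>Tseng's method on a closed subspace\<close>

text \<open>The backward operator enters only through its resolvent \<open>J\<close>, so that a zero
  of the sum is a fixed point of the forward-backward map, as in \<open>sol\<close>. Weak
  convergence is tested on \<open>U\<close>, which contains the iterates.\<close>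

lemma forward_backward_forward_weak:
  fixes u q :: "nat \<Rightarrow> 'a::{real_inner, complete_space}"
  assumes U: "closed U" "subspace U"
    and J: "J ` U \<subseteq> U"
    and firm: "\<And>a b. a \<in> U \<Longrightarrow> b \<in> U \<Longrightarrow> 0 \<le> inner (J a - J b) ((a - J a) - (b - J b))"
    and F: "F ` U \<subseteq> U"
    and lip: "\<And>a b. a \<in> U \<Longrightarrow> b \<in> U \<Longrightarrow> norm (F a - F b) \<le> L * norm (a - b)"
    and mono: "\<And>a b. a \<in> U \<Longrightarrow> b \<in> U \<Longrightarrow> 0 \<le> inner (F a - F b) (a - b)"
    and \<gamma>: "0 < \<gamma>" and L: "0 \<le> L" and \<gamma>L: "\<gamma> * L < 1"
    and u0: "u 0 \<in> U"
    and q: "\<And>k. q k = J (u k - \<gamma> *\<^sub>R F (u k))"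
    and u: "\<And>k. u (Suc k) = q k + \<gamma> *\<^sub>R (F (u k) - F (q k))"
    and sol: "s \<in> U" "J (s - \<gamma> *\<^sub>R F s) = s"
  obtains z where "z \<in> U" "(\<lambda>k. norm (q k - u k)) \<longlonglongrightarrow> 0"
    "\<And>a. a \<in> U \<Longrightarrow> (\<lambda>k. inner (u k - z) a) \<longlonglongrightarrow> 0"
proof -
  define c where "c = 1 - (\<gamma> * L)\<^sup>2"
  have \<gamma>L0: "0 \<le> \<gamma> * L" using \<gamma> L by simp
  have c: "0 < c" using \<gamma>L \<gamma>L0 by (simp add: c_def power_less_one_iff abs_square_less_1)
  have step_U: "a - \<gamma> *\<^sub>R F b \<in> U" if "a \<in> U" "b \<in> U" for a b
    using that F U(2) by (meson image_subset_iff subspace_diff subspace_scale)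
  have J_nonexp: "norm (J a - J b) \<le> norm (a - b)" if "a \<in> U" "b \<in> U" for a b
    using firmly_nonexpansive_imp_nonexpansive firm[OF that] .
  have qU': "u k \<in> U \<Longrightarrow> q k \<in> U" for k
    unfolding q using step_U[of "u k" "u k"] J by blast
  have uU: "u k \<in> U" for k
  proof (induction k)
    case (Suc k)
    then have "q k \<in> U" "F (u k) - F (q k) \<in> U"
      using qU' F subspace_diff[OF U(2)] by blast+
    then show ?case unfolding u
      by (intro subspace_add[OF U(2)] subspace_scale[OF U(2)])
  qed (rule u0)
  have qU: "q k \<in> U" for k using qU' uU by blast
  \<comment> \<open>Firmness of \<open>J\<close> at the arguments of \<open>q k\<close> and
    \<open>z\<close>, added to monotonicity of \<open>F\<close>, makes the cross term nonnegative;
    the Lipschitz bound on the correction \<open>e\<close> leaves the factor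
    \<open>c\<close>.\<close>
  have descent: "c * (norm (q k - u k))\<^sup>2 \<le> (norm (u k - z))\<^sup>2 - (norm (u (Suc k) - z))\<^sup>2"
    if z: "z \<in> U" "J (z - \<gamma> *\<^sub>R F z) = z" for z k
  proof -
    define e where "e = \<gamma> *\<^sub>R (F (u k) - F (q k))"
    have "0 \<le> inner (q k - z) ((u k - \<gamma> *\<^sub>R F (u k) - q k) - (- \<gamma> *\<^sub>R F z))"
      using firm[OF step_U[OF uU uU] step_U[OF z(1) z(1)], of k k] z(2) q[of k] by simp
    moreover have "0 \<le> \<gamma> * inner (q k - z) (F (q k) - F z)"
      using mono[OF qU z(1), of k] \<gamma> by (simp add: inner_commute)
    ultimately have 1: "0 \<le> inner (q k - z) (u k - q k - e)"
      by (simp add: e_def inner_diff_right algebra_simps)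
    have "norm e \<le> \<gamma> * (L * norm (u k - q k))"
      unfolding e_def using lip[OF uU qU, of k k] \<gamma> by simp
    then have "(norm e)\<^sup>2 \<le> (\<gamma> * (L * norm (u k - q k)))\<^sup>2" by (simp add: power_mono)
    then have 2: "(norm e)\<^sup>2 \<le> (\<gamma> * L)\<^sup>2 * (norm (q k - u k))\<^sup>2"
      by (simp add: power_mult_distrib norm_minus_commute)
    have "(norm (u k - z))\<^sup>2 - (norm (q k + e - z))\<^sup>2 =
        (norm (q k - u k))\<^sup>2 - (norm e)\<^sup>2 + 2 * inner (q k - z) (u k - q k - e)"
      unfolding power2_norm_eq_inner
      by (simp add: inner_diff_left inner_diff_right inner_add_left inner_add_right
          inner_commute algebra_simps)
    moreover have "q k + e = u (Suc k)" by (simp add: u e_def)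
    moreover have "c * (norm (q k - u k))\<^sup>2 =
        (norm (q k - u k))\<^sup>2 - (\<gamma> * L)\<^sup>2 * (norm (q k - u k))\<^sup>2"
      by (simp add: c_def left_diff_distrib)
    ultimately show ?thesis using 1 2 by simp
  qed
  have dec: "norm (u (Suc k) - z) \<le> norm (u k - z)"
    if "z \<in> U" "J (z - \<gamma> *\<^sub>R F z) = z" for z k
  proof -
    have "0 \<le> c * (norm (q k - u k))\<^sup>2" using c by simp
    then have "(norm (u (Suc k) - z))\<^sup>2 \<le> (norm (u k - z))\<^sup>2"
      using descent[OF that, of k] by linarith
    then show ?thesis by (rule power2_le_imp_le) simp
  qed
  have fejer: "convergent (\<lambda>k. norm (u k - z))"
    if "z \<in> U" "J (z - \<gamma> *\<^sub>R F z) = z" for z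
  proof -
    have "decseq (\<lambda>k. norm (u k - z))" by (rule decseq_SucI) (rule dec[OF that])
    then obtain l where "(\<lambda>k. norm (u k - z)) \<longlonglongrightarrow> l"
      by (rule decseq_convergent[where B = 0]) auto
    then show ?thesis by (rule convergentI)
  qed
  obtain d where d: "(\<lambda>k. norm (u k - s)) \<longlonglongrightarrow> d"
    using fejer[OF sol] by (auto simp: convergent_def)
  \<comment> \<open>By descent these squares are bounded by consecutive differences of a convergent
    sequence, divided by \<open>c\<close>.\<close>
  have "(\<lambda>k. (norm (q k - u k))\<^sup>2) \<longlonglongrightarrow> 0"
  proof (rule Lim_null_comparison)
    show "\<forall>\<^sub>F k in sequentially. norm ((norm (q k - u k))\<^sup>2)
        \<le> ((norm (u k - s))\<^sup>2 - (norm (u (Suc k) - s))\<^sup>2) / c"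
      using descent[OF sol] c by (simp add: pos_le_divide_eq mult.commute)
    have "(\<lambda>k. ((norm (u k - s))\<^sup>2 - (norm (u (Suc k) - s))\<^sup>2) / c) \<longlonglongrightarrow> (d\<^sup>2 - d\<^sup>2) / c"
      by (intro tendsto_intros d LIMSEQ_Suc[OF d]) (use c in simp)
    then show "(\<lambda>k. ((norm (u k - s))\<^sup>2 - (norm (u (Suc k) - s))\<^sup>2) / c) \<longlonglongrightarrow> 0"
      by simp
  qed
  then have res: "(\<lambda>k. norm (q k - u k)) \<longlonglongrightarrow> 0"
    using tendsto_real_sqrt[of "\<lambda>k. (norm (q k - u k))\<^sup>2" 0] by simp
  have bdd: "bounded (range u)"
  proof -
    obtain K where K: "\<And>k. norm (u k - s) \<le> K"
      using convergent_imp_bounded[OF d] by (auto simp: bounded_iff)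
    have "norm (u k) \<le> K + norm s" for k
      using norm_triangle_ineq[of "u k - s" s] K[of k] by simp
    then show ?thesis by (auto simp: bounded_iff)
  qed
  \<comment> \<open>\<open>T\<close> is the resolvent of \<open>\<gamma>(F + M)\<close>, where \<open>J\<close> is the resolvent of \<open>\<gamma>M\<close>.\<close>
  have "\<exists>!p\<in>U. J (a - \<gamma> *\<^sub>R F p) = p" if a: "a \<in> U" for a
  proof (rule Banach_fix)
    show "complete U" using U(1) by (simp add: complete_eq_closed)
    show "U \<noteq> {}" using a by blast
    show "0 \<le> \<gamma> * L" "\<gamma> * L < 1" using \<gamma>L0 \<gamma>L by auto
    show "(\<lambda>p. J (a - \<gamma> *\<^sub>R F p)) ` U \<subseteq> U" using step_U[OF a] J by blast
    show "dist (J (a - \<gamma> *\<^sub>R F p)) (J (a - \<gamma> *\<^sub>R F p')) \<le> \<gamma> * L * dist p p'"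
      if p: "p \<in> U" "p' \<in> U" for p p'
    proof -
      have "norm (J (a - \<gamma> *\<^sub>R F p) - J (a - \<gamma> *\<^sub>R F p'))
          \<le> norm ((a - \<gamma> *\<^sub>R F p) - (a - \<gamma> *\<^sub>R F p'))"
        by (intro J_nonexp step_U a p)
      also have "\<dots> = \<gamma> * norm (F p - F p')"
        using \<gamma> by (simp add: norm_minus_commute flip: scaleR_diff_right)
      also have "\<dots> \<le> \<gamma> * (L * norm (p - p'))" using lip[OF p] \<gamma> by simp
      finally show ?thesis by (simp add: dist_norm mult.assoc)
    qed
  qed
  then obtain T where T: "\<And>a. a \<in> U \<Longrightarrow> T a \<in> U"
      "\<And>a. a \<in> U \<Longrightarrow> J (a - \<gamma> *\<^sub>R F (T a)) = T a"
    by metis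
  \<comment> \<open>Adding monotonicity of \<open>F\<close> to firmness of \<open>J\<close> cancels
    the \<open>F\<close> terms, so \<open>T\<close> is itself firmly nonexpansive.\<close>
  have T_nonexp: "norm (T a - T b) \<le> norm (a - b)" if ab: "a \<in> U" "b \<in> U" for a b
  proof -
    have "0 \<le> inner (T a - T b) ((a - \<gamma> *\<^sub>R F (T a) - T a) - (b - \<gamma> *\<^sub>R F (T b) - T b))"
      using firm[OF step_U step_U, of a "T a" b "T b"] ab T by simp
    moreover have "0 \<le> \<gamma> * inner (T a - T b) (F (T a) - F (T b))"
      using mono[OF T(1)[OF ab(1)] T(1)[OF ab(2)]] \<gamma> by (simp add: inner_commute)
    ultimately have "0 \<le> inner (T a - T b) ((a - T a) - (b - T b))"
      by (simp add: inner_diff_right algebra_simps)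
    then show ?thesis by (rule firmly_nonexpansive_imp_nonexpansive)
  qed
  \<comment> \<open>\<open>q k\<close> and \<open>T (u k)\<close> are values of \<open>J\<close> at
    arguments differing only in the \<open>F\<close> term, which costs
    \<open>\<gamma> * L * norm (u k - T (u k))\<close>; since \<open>\<gamma> * L < 1\<close> the
    triangle inequality absorbs it.\<close>
  have T_near: "norm (u k - T (u k)) \<le> norm (q k - u k) / (1 - \<gamma> * L)" for k
  proof -
    let ?p = "T (u k)"
    have "norm (q k - ?p) \<le> norm ((u k - \<gamma> *\<^sub>R F (u k)) - (u k - \<gamma> *\<^sub>R F ?p))"
      using J_nonexp[OF step_U[OF uU uU] step_U[OF uU T(1)[OF uU]], of k k k k] T(2)[OF uU, of k]
      by (simp add: q)
    also have "\<dots> = \<gamma> * norm (F (u k) - F ?p)"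
      using \<gamma> by (simp add: norm_minus_commute flip: scaleR_diff_right)
    also have "\<dots> \<le> \<gamma> * (L * norm (u k - ?p))" using lip[OF uU T(1)[OF uU], of k k] \<gamma> by simp
    finally have "norm (q k - ?p) \<le> \<gamma> * L * norm (u k - ?p)" by simp
    moreover have "norm (u k - ?p) \<le> norm (q k - u k) + norm (q k - ?p)"
      using norm_triangle_ineq4[of "q k - ?p" "q k - u k"] by simp
    ultimately show ?thesis using \<gamma>L by (simp add: field_simps)
  qed
  have T_reg: "(\<lambda>k. u k - T (u k)) \<longlonglongrightarrow> 0"
  proof (rule Lim_null_comparison)
    show "\<forall>\<^sub>F k in sequentially. norm (u k - T (u k)) \<le> norm (q k - u k) / (1 - \<gamma> * L)"
      using T_near by simp
    show "(\<lambda>k. norm (q k - u k) / (1 - \<gamma> * L)) \<longlonglongrightarrow> 0"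
      using tendsto_divide[OF res tendsto_const[of "1 - \<gamma> * L"]] \<gamma>L by simp
  qed
  have T_fejer: "convergent (\<lambda>k. norm (u k - z))" if "z \<in> U" "T z = z" for z
    using fejer[OF that(1)] T(2)[OF that(1)] that(2) by simp
  have TU: "T ` U \<subseteq> U" using T(1) by blast
  obtain z where "z \<in> U" "\<And>a. a \<in> U \<Longrightarrow> (\<lambda>k. inner (u k - z) a) \<longlonglongrightarrow> 0"
    using nonexpansive_weak_limit[where T = T, OF U TU T_nonexp uU bdd T_reg T_fejer] by metis
  then show ?thesis using that res by blast
qed

section \<open>Passing between the range of \<open>v\<close> and its closure\<close>

lemma subspace_closure:
  fixes D :: "'a::real_normed_vector set"
  assumes D: "subspace D"
  shows "subspace (closure D)"
proof (rule subspaceI)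
  show "0 \<in> closure D" using subspace_0[OF D] closure_subset by blast
  show "a + b \<in> closure D" if ab: "a \<in> closure D" "b \<in> closure D" for a b
  proof -
    obtain f g where "\<forall>n. f n \<in> D" "f \<longlonglongrightarrow> a" "\<forall>n. g n \<in> D" "g \<longlonglongrightarrow> b"
      using ab unfolding closure_sequential by blast
    then have "\<forall>n. f n + g n \<in> D" "(\<lambda>n. f n + g n) \<longlonglongrightarrow> a + b"
      by (auto intro: subspace_add[OF D] tendsto_add)
    then show ?thesis unfolding closure_sequential
      by (intro exI[of _ "\<lambda>n. f n + g n"] conjI)
  qed
  show "t *\<^sub>R a \<in> closure D" if a: "a \<in> closure D" for t a
  proof -
    obtain f where "\<forall>n. f n \<in> D" "f \<longlonglongrightarrow> a"
      using a unfolding closure_sequential by blast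
    then have "\<forall>n. t *\<^sub>R f n \<in> D" "(\<lambda>n. t *\<^sub>R f n) \<longlonglongrightarrow> t *\<^sub>R a"
      by (auto intro: subspace_scale[OF D] tendsto_scaleR)
    then show ?thesis unfolding closure_sequential
      by (intro exI[of _ "\<lambda>n. t *\<^sub>R f n"] conjI)
  qed
qed

text \<open>The inverse of \<open>v\<close> extends to a bounded linear map on the closure of the
  range, and such a map is weakly continuous. The extension sends \<open>z\<close> to the limit
  \<open>\<zeta>\<close> of the preimages \<open>e n\<close>; weak continuity is shown by separating
  a convex set from 0. As \<open>v\<close> need not be continuous, \<open>z\<close> may differ from
  \<open>v \<zeta>\<close>.\<close>

lemma weakly_tendsto_of_image:
  fixes v :: "'a::{real_inner, complete_space} \<Rightarrow> 'a"
  assumes v: "linear v" and low: "\<And>e. norm e \<le> C * norm (v e)"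
    and z: "z \<in> closure (range v)"
    and lim: "\<And>a. a \<in> closure (range v) \<Longrightarrow> (\<lambda>k. inner (v (x k) - z) a) \<longlonglongrightarrow> 0"
  obtains \<zeta> where "weakly_tendsto x \<zeta>"
proof -
  obtain e where e: "(\<lambda>n. v (e n)) \<longlonglongrightarrow> z"
  proof -
    obtain d where d: "\<forall>n. d n \<in> range v" "d \<longlonglongrightarrow> z"
      using z unfolding closure_sequential by blast
    have "d = (\<lambda>n. v (inv v (d n)))" using d(1) by (simp add: f_inv_into_f)
    with d(2) show ?thesis using that by metis
  qed
  have "Cauchy e"
  proof (rule metric_CauchyI)
    fix \<epsilon> :: real assume \<epsilon>: "0 < \<epsilon>"
    \<comment> \<open>The sign of \<open>C\<close> is not prescribed, so a positive bound replaces
      it before dividing.\<close>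
    define K where "K = \<bar>C\<bar> + 1"
    have K: "0 < K" by (simp add: K_def add_nonneg_pos)
    obtain M where M: "\<And>m n. M \<le> m \<Longrightarrow> M \<le> n \<Longrightarrow> dist (v (e m)) (v (e n)) < \<epsilon> / K"
      using metric_CauchyD[OF LIMSEQ_imp_Cauchy[OF e], of "\<epsilon> / K"] \<epsilon> K by auto
    have "dist (e m) (e n) < \<epsilon>" if "M \<le> m" "M \<le> n" for m n
    proof -
      have "norm (e m - e n) \<le> C * norm (v (e m) - v (e n))"
        using low[of "e m - e n"] by (simp add: linear_diff[OF v])
      also have "\<dots> \<le> K * norm (v (e m) - v (e n))"
        by (rule mult_right_mono) (auto simp: K_def)
      also have "\<dots> < \<epsilon>" using M[OF that] K by (simp add: dist_norm field_simps)
      finally show ?thesis by (simp add: dist_norm)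
    qed
    then show "\<exists>M. \<forall>m\<ge>M. \<forall>n\<ge>M. dist (e m) (e n) < \<epsilon>" by blast
  qed
  then obtain \<zeta> where \<zeta>: "e \<longlonglongrightarrow> \<zeta>"
    using Cauchy_convergent convergent_def by blast
  have half: "\<forall>\<^sub>F k in sequentially. inner (x k - \<zeta>) h < \<epsilon>" if \<epsilon>: "0 < \<epsilon>" for h \<epsilon>
  proof (rule ccontr)
    assume "\<not> ?thesis"
    from not_eventually_sequentiallyD[OF this] obtain r :: "nat \<Rightarrow> nat"
      where r: "strict_mono r" and ge: "\<And>k. \<epsilon> \<le> inner (x (r k) - \<zeta>) h"
      by (auto simp: not_less)
    \<comment> \<open>Halving \<open>\<epsilon>\<close> leaves room to replace
      \<open>\<zeta>\<close> by \<open>e n\<close>: for large \<open>n\<close> the vector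
      \<open>x (r k) - e n\<close> lies in \<open>H\<close>.\<close>
    define H where "H = {d. \<epsilon> / 2 \<le> inner d h}"
    \<comment> \<open>\<open>W\<close> contains all \<open>v (x (r k)) - z\<close> but not \<open>0\<close>, so its element of least norm separates it from \<open>0\<close>.\<close>
    define W where "W = closure (v ` H)"
    have "convex H"
      using convex_halfspace_ge[of "\<epsilon> / 2" h] by (simp add: H_def inner_commute)
    then have W: "closed W" "convex W"
      by (simp_all add: W_def convex_linear_image[OF v])
    have W_mem: "v (x (r k)) - z \<in> W" for k
    proof (rule Lim_in_closed_set[OF W(1)])
      have "(\<lambda>n. inner (x (r k) - e n) h) \<longlonglongrightarrow> inner (x (r k) - \<zeta>) h"
        by (intro tendsto_intros \<zeta>)
      then have "\<forall>\<^sub>F n in sequentially. \<epsilon> / 2 < inner (x (r k) - e n) h"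
        by (rule order_tendstoD) (use ge[of k] \<epsilon> in linarith)
      then show "\<forall>\<^sub>F n in sequentially. v (x (r k) - e n) \<in> W"
      proof eventually_elim
        case (elim n)
        then show ?case unfolding W_def H_def
          by (intro subsetD[OF closure_subset]) auto
      qed
      show "(\<lambda>n. v (x (r k) - e n)) \<longlonglongrightarrow> v (x (r k)) - z"
        unfolding linear_diff[OF v] by (intro tendsto_intros e)
    qed simp
    then have "W \<noteq> {}" by blast
    then obtain a where a: "a \<in> W" "\<And>c. c \<in> W \<Longrightarrow> inner a a \<le> inner c a"
      using closed_convex_min_norm[OF W] by blast
    have "\<epsilon> / 2 \<le> C * norm a * norm h"
    proof (rule continuous_ge_on_closure[of "v ` H" "\<lambda>c. C * norm c * norm h"])
      show "continuous_on (closure (v ` H)) (\<lambda>c. C * norm c * norm h)"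
        by (intro continuous_intros)
      show "a \<in> closure (v ` H)" using a(1) by (simp add: W_def)
      fix c assume "c \<in> v ` H"
      then obtain d where d: "c = v d" "\<epsilon> / 2 \<le> inner d h" by (auto simp: H_def)
      note d(2)
      also have "inner d h \<le> norm d * norm h" by (rule norm_cauchy_schwarz)
      also have "\<dots> \<le> C * norm (v d) * norm h" using low by (rule mult_right_mono) simp
      finally show "\<epsilon> / 2 \<le> C * norm c * norm h" using d(1) by simp
    qed
    then have "a \<noteq> 0" using \<epsilon> by auto
    have "a \<in> closure (range v)"
      using a(1) closure_mono[of "v ` H" "range v"] by (auto simp: W_def)
    from LIMSEQ_subseq_LIMSEQ[OF lim[OF this] r]
    have "(\<lambda>k. inner (v (x (r k)) - z) a) \<longlonglongrightarrow> 0" by (simp add: o_def)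
    then have "inner a a \<le> 0"
      by (rule tendsto_lowerbound) (use a(2) W_mem in auto)
    then show False using \<open>a \<noteq> 0\<close> by (metis inner_gt_zero_iff not_less)
  qed
  have "(\<lambda>k. inner (x k - \<zeta>) h) \<longlonglongrightarrow> 0" for h
  proof (rule tendstoI)
    fix \<epsilon> :: real assume \<epsilon>: "0 < \<epsilon>"
    from half[OF \<epsilon>, of h] half[OF \<epsilon>, of "- h"]
    show "\<forall>\<^sub>F k in sequentially. dist (inner (x k - \<zeta>) h) 0 < \<epsilon>"
      by eventually_elim (auto simp: dist_real_def)
  qed
  then have "weakly_tendsto x \<zeta>"
    unfolding weakly_tendsto_def inner_diff_left by (simp add: LIM_zero_iff)
  then show ?thesis by (rule that)
qed

text \<open>Carries firmness and monotonicity inequalities from the range of \<open>v\<close> to its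
  closure.\<close>

lemma nonneg_on_closure_pair:
  fixes f :: "'a::metric_space \<Rightarrow> 'a \<Rightarrow> real"
  assumes cont: "continuous_on (closure D \<times> closure D) (\<lambda>p. f (fst p) (snd p))"
    and nonneg: "\<And>a b. a \<in> D \<Longrightarrow> b \<in> D \<Longrightarrow> 0 \<le> f a b"
    and ab: "a \<in> closure D" "b \<in> closure D"
  shows "0 \<le> f a b"
  using continuous_ge_on_closure[of "D \<times> D" "\<lambda>p. f (fst p) (snd p)" "(a, b)" 0] assms
  by (auto simp: closure_Times)

lemma mem_sum_scale_single_iff:
  "d \<in> sum_op (scale_op \<gamma> B) (single_op v) p \<longleftrightarrow> (\<exists>b\<in>B p. d = \<gamma> *\<^sub>R b + v p)"
  by (auto simp: sum_op_def scale_op_def single_op_def set_plus_def)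

lemma mem_sum_single_iff:
  "d \<in> sum_op (single_op A) B p \<longleftrightarrow> (\<exists>b\<in>B p. d = A p + b)"
  by (auto simp: sum_op_def single_op_def set_plus_def)

text \<open>Since \<open>d - v p\<close> is \<open>\<gamma>\<close> times an element of
  \<open>B p\<close>, monotonicity of the pair says that the relation sending \<open>d\<close> to
  \<open>v p\<close>, the resolvent of \<open>\<gamma>B \<circ> v\<inverse>\<close>, is firmly
  nonexpansive.\<close>

lemma monotone_pair_resolvent_firm:
  fixes v :: "'a::real_inner \<Rightarrow> 'a"
  assumes mono: "monotone_pair B (single_op v)" and \<gamma>: "0 \<le> \<gamma>"
    and p: "d \<in> sum_op (scale_op \<gamma> B) (single_op v) p"
    and q: "d' \<in> sum_op (scale_op \<gamma> B) (single_op v) q"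
  shows "0 \<le> inner (v p - v q) ((d - v p) - (d' - v q))"
proof -
  obtain b c where bc: "b \<in> B p" "d = \<gamma> *\<^sub>R b + v p" "c \<in> B q" "d' = \<gamma> *\<^sub>R c + v q"
    using p q by (auto simp: mem_sum_scale_single_iff)
  have "0 \<le> \<gamma> * inner (b - c) (v p - v q)"
    using mono bc \<gamma> by (auto simp: monotone_pair_def single_op_def)
  then show ?thesis using bc by (simp add: inner_commute flip: scaleR_diff_right)
qed

theorem theorem3p4:
  fixes A v :: "'a::{real_inner, complete_space} \<Rightarrow> 'a"
    and B :: "'a \<Rightarrow> 'a set"
    and S :: "'a set"
    and \<gamma> L :: real
    and x y :: "nat \<Rightarrow> 'a"
  assumes S_eq: "S = {z. 0 \<in> sum_op (single_op A) B z}"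
    and S_nonempty: "S \<noteq> {}"
    and v_linear: "linear v"
    and mono_A: "monotone_pair (single_op A) (single_op v)"
    and mono_B: "monotone_pair B (single_op v)"
    and \<gamma>_pos: "\<gamma> > 0"
    and ran_A: "range A \<subseteq> range v"
    and ran_v: "range v \<subseteq> ran_op (sum_op (scale_op \<gamma> B) (single_op v))"
    and L_pos: "L > 0"
    and lip: "lipschitz_pair L A v"
    and \<gamma>_less: "\<gamma> < 1 / L"
    and y_step: "\<And>k. y k \<in> inv_op (sum_op (scale_op \<gamma> B) (single_op v)) (v (x k) - \<gamma> *\<^sub>R A (x k))"
    and x_step: "\<And>k. x (Suc k) \<in> {y k} + scale_op \<gamma> (inv_op (single_op v)) (A (x k) - A (y k))"
  shows "((\<lambda>k. norm (v (y k) - v (x k))) \<longlonglongrightarrow> 0) \<and>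
    ((\<forall>ystar. weak_cluster_point y ystar \<and> weak_strong_seq_closed (sum_op (single_op A) B)
        \<longrightarrow> ystar \<in> S) \<and>
     (weak_strong_seq_closed (sum_op (single_op A) B) \<and> lipschitz_inverse v
        \<longrightarrow> (\<exists>s \<in> S. weakly_tendsto x s))) \<and>
    (R_continuous_at (inv_op (sum_op (single_op A) B)) 0 \<longrightarrow> (\<lambda>k. infdist (y k) S) \<longlonglongrightarrow> 0)"
proof -
  define D where "D = range v"
  define U where "U = closure D"
  have D: "subspace D" unfolding D_def using v_linear by (simp add: linear_subspace_image)
  have U: "closed U" "subspace U" by (simp_all add: U_def D subspace_closure)
  have DU: "D \<subseteq> U" unfolding U_def by (rule closure_subset)
  have vD: "v a \<in> D" and AD: "A a \<in> D" for a using ran_A by (auto simp: D_def)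
  have \<gamma>L: "\<gamma> * L < 1" using \<gamma>_less L_pos by (simp add: field_simps)

  \<comment> \<open>Extending the resolvent and the forward map to the closure\<close>
  let ?R = "sum_op (scale_op \<gamma> B) (single_op v)"
  have "\<exists>p. d \<in> ?R p" if "d \<in> D" for d
    using that ran_v by (auto simp: D_def ran_op_def)
  then obtain P where P: "\<And>d. d \<in> D \<Longrightarrow> d \<in> ?R (P d)" by metis
  define J0 where "J0 d = v (P d)" for d
  note firm_R = monotone_pair_resolvent_firm[OF mono_B less_imp_le[OF \<gamma>_pos]]
  have J0_firm: "0 \<le> inner (J0 a - J0 b) ((a - J0 a) - (b - J0 b))" if "a \<in> D" "b \<in> D" for a b
    unfolding J0_def using that by (intro firm_R P)
  \<comment> \<open>Nonexpansiveness with both arguments equal to \<open>d\<close> shows that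
    \<open>v p\<close> is the same for all admissible \<open>p\<close>; hence \<open>v (y k)\<close>
    is determined even when \<open>y k\<close> is not.\<close>
  have J0_eq: "J0 d = v p" if "d \<in> D" "d \<in> ?R p" for d p
    using firmly_nonexpansive_imp_nonexpansive[OF firm_R[OF P[OF that(1)] that(2)]]
    by (simp add: J0_def)
  have "1-lipschitz_on D J0"
    by (rule lipschitz_onI)
      (use firmly_nonexpansive_imp_nonexpansive[OF J0_firm] in \<open>auto simp: dist_norm\<close>)
  then obtain J where J_lip: "1-lipschitz_on U J" and J: "\<And>d. d \<in> D \<Longrightarrow> J d = J0 d"
    unfolding U_def using lipschitz_extend_closure by blast
  note J_cont = lipschitz_on_continuous_on[OF J_lip]

  define F0 where "F0 d = A (inv v d)" for d
  \<comment> \<open>The Lipschitz property of the pair makes \<open>A\<close> constant on the fibres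
    of \<open>v\<close>, so the preimage picked by \<open>inv v\<close> is immaterial.\<close>
  have F0_v: "F0 (v a) = A a" for a
  proof -
    have "norm (A (inv v (v a)) - A a) \<le> L * norm (v (inv v (v a)) - v a)"
      using lip unfolding lipschitz_pair_def by blast
    then show ?thesis by (simp add: F0_def f_inv_into_f)
  qed
  have "L-lipschitz_on D F0"
    by (rule lipschitz_onI)
      (use L_pos lip in \<open>auto simp: D_def F0_v dist_norm lipschitz_pair_def\<close>)
  then obtain F where F_lip: "L-lipschitz_on U F" and F: "\<And>d. d \<in> D \<Longrightarrow> F d = F0 d"
    unfolding U_def using lipschitz_extend_closure by blast
  note F_cont = lipschitz_on_continuous_on[OF F_lip]
  have F_v: "F (v a) = A a" for a using F[OF vD] F0_v by simp

  have JU: "J ` U \<subseteq> U"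
    using J_cont U(1) J vD DU unfolding U_def by (intro image_closure_subset) (auto simp: J0_def)
  have FU: "F ` U \<subseteq> U"
    using F_cont U(1) F AD DU unfolding U_def by (intro image_closure_subset) (auto simp: F0_def)
  have J_firm: "0 \<le> inner (J a - J b) ((a - J a) - (b - J b))" if "a \<in> U" "b \<in> U" for a b
  proof (rule nonneg_on_closure_pair[of D "\<lambda>a b. inner (J a - J b) ((a - J a) - (b - J b))"])
    show "continuous_on (closure D \<times> closure D) (\<lambda>p. inner (J (fst p) - J (snd p))
        ((fst p - J (fst p)) - (snd p - J (snd p))))"
      unfolding U_def[symmetric]
      by (intro continuous_intros continuous_on_compose2[OF J_cont]) auto
  qed (use that J J0_firm in \<open>auto simp: U_def\<close>)
  have F_mono: "0 \<le> inner (F a - F b) (a - b)" if "a \<in> U" "b \<in> U" for a b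
  proof (rule nonneg_on_closure_pair[of D "\<lambda>a b. inner (F a - F b) (a - b)"])
    show "continuous_on (closure D \<times> closure D) (\<lambda>p. inner (F (fst p) - F (snd p)) (fst p - snd p))"
      unfolding U_def[symmetric]
      by (intro continuous_intros continuous_on_compose2[OF F_cont]) auto
    fix a b assume "a \<in> D" "b \<in> D"
    then show "0 \<le> inner (F a - F b) (a - b)"
      using mono_A by (auto simp: D_def F_v monotone_pair_def single_op_def)
  qed (use that in \<open>auto simp: U_def\<close>)
  have F_L: "norm (F a - F b) \<le> L * norm (a - b)" if "a \<in> U" "b \<in> U" for a b
    using lipschitz_onD[OF F_lip that] by (simp add: dist_norm)

  \<comment> \<open>The iteration in the variables \<open>v (x k)\<close> and
    \<open>v (y k)\<close>\<close>
  have step_D: "v a - \<gamma> *\<^sub>R A a \<in> D" for a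
    using D vD AD by (intro subspace_diff subspace_scale)
  have q: "v (y k) = J (v (x k) - \<gamma> *\<^sub>R F (v (x k)))" for k
    using J0_eq[OF step_D, of "x k" "y k"] y_step[of k] J[OF step_D, of "x k"]
    by (simp add: F_v inv_op_def)
  \<comment> \<open>Applying \<open>v\<close> removes the choice made in the set-valued
    inverse.\<close>
  have u: "v (x (Suc k)) = v (y k) + \<gamma> *\<^sub>R (F (v (x k)) - F (v (y k)))" for k
  proof -
    obtain e where "x (Suc k) = y k + \<gamma> *\<^sub>R e" "A (x k) - A (y k) = v e"
      using x_step[of k] by (fastforce simp: scale_op_def inv_op_def single_op_def set_plus_def)
    then show ?thesis by (simp add: linear_add[OF v_linear] linear_scale[OF v_linear] F_v)
  qed
  obtain s where s: "s \<in> S" using S_nonempty by blast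
  then obtain b where b: "b \<in> B s" "0 = A s + b" by (auto simp: S_eq mem_sum_single_iff)
  then have "v s - \<gamma> *\<^sub>R A s \<in> ?R s"
    by (auto simp: mem_sum_scale_single_iff add_eq_0_iff intro!: bexI[of _ b])
  then have sol: "v s \<in> U" "J (v s - \<gamma> *\<^sub>R F (v s)) = v s"
    using J0_eq[OF step_D] J[OF step_D] vD DU by (auto simp: F_v)
  have u0: "v (x 0) \<in> U" using vD DU by blast
  obtain z where z: "z \<in> U"
    and res: "(\<lambda>k. norm (v (y k) - v (x k))) \<longlonglongrightarrow> 0"
    and weak: "\<And>a. a \<in> U \<Longrightarrow> (\<lambda>k. inner (v (x k) - z) a) \<longlonglongrightarrow> 0"
    using forward_backward_forward_weak[where u = "\<lambda>k. v (x k)" and q = "\<lambda>k. v (y k)",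
        OF U JU J_firm FU F_L F_mono \<gamma>_pos less_imp_le[OF L_pos] \<gamma>L u0 q u sol]
    by metis

  \<comment> \<open>Vanishing residuals in the inclusion\<close>
  \<comment> \<open>Solving the inclusion for \<open>y k\<close> gives an element of
    \<open>B (y k)\<close>; adding \<open>A (y k)\<close> to it yields \<open>c k\<close>.\<close>
  define c where "c k = (1 / \<gamma>) *\<^sub>R (v (x k) - v (y k)) - (A (x k) - A (y k))" for k
  have c_mem: "c k \<in> sum_op (single_op A) B (y k)" for k
  proof -
    obtain b where b: "b \<in> B (y k)" "v (x k) - \<gamma> *\<^sub>R A (x k) = \<gamma> *\<^sub>R b + v (y k)"
      using y_step[of k] by (auto simp: inv_op_def mem_sum_scale_single_iff)
    then have "v (x k) - v (y k) = \<gamma> *\<^sub>R (b + A (x k))" by (simp add: algebra_simps)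
    then have "c k = A (y k) + b" using \<gamma>_pos by (simp add: c_def)
    then show ?thesis using b(1) by (auto simp: mem_sum_single_iff)
  qed
  have c_lim: "c \<longlonglongrightarrow> 0"
  proof (rule Lim_null_comparison)
    have "norm (c k) \<le> (1 / \<gamma> + L) * norm (v (y k) - v (x k))" for k
    proof -
      have "norm (c k) \<le> (1 / \<gamma>) * norm (v (x k) - v (y k)) + norm (A (x k) - A (y k))"
        unfolding c_def using norm_triangle_ineq4 \<gamma>_pos by (metis abs_of_pos norm_scaleR zero_less_divide_1_iff)
      also have "norm (A (x k) - A (y k)) \<le> L * norm (v (x k) - v (y k))"
        using lip by (simp add: lipschitz_pair_def)
      finally show ?thesis by (simp add: norm_minus_commute distrib_right)
    qed
    then show "\<forall>\<^sub>F k in sequentially. norm (c k) \<le> (1 / \<gamma> + L) * norm (v (y k) - v (x k))"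
      by simp
    show "(\<lambda>k. (1 / \<gamma> + L) * norm (v (y k) - v (x k))) \<longlonglongrightarrow> 0"
      using tendsto_mult_right_zero[OF res] by simp
  qed

  \<comment> \<open>Weak cluster points and weak convergence\<close>
  have cluster: "ystar \<in> S"
    if wc: "weak_cluster_point y ystar" and cl: "weak_strong_seq_closed (sum_op (single_op A) B)"
    for ystar
  proof -
    obtain r where r: "strict_mono r" "weakly_tendsto (y \<circ> r) ystar"
      using wc by (auto simp: weak_cluster_point_def)
    have "(c \<circ> r) \<longlonglongrightarrow> 0" using LIMSEQ_subseq_LIMSEQ[OF c_lim r(1)] .
    moreover have "\<forall>k. (c \<circ> r) k \<in> sum_op (single_op A) B ((y \<circ> r) k)" using c_mem by simp
    ultimately show ?thesis
      using cl r(2) unfolding weak_strong_seq_closed_def S_eq by blast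
  qed
  moreover have "\<exists>s\<in>S. weakly_tendsto x s"
    if cl: "weak_strong_seq_closed (sum_op (single_op A) B)" and li: "lipschitz_inverse v"
  proof -
    obtain w C where w: "\<And>d. d \<in> range v \<Longrightarrow> inv_op (single_op v) d = {w d}"
      and C: "C-lipschitz_on (range v) w"
      using li by (auto simp: lipschitz_inverse_def)
    have wv: "w (v a) = a" for a
    proof -
      have "a \<in> inv_op (single_op v) (v a)" by (simp add: inv_op_def single_op_def)
      then show ?thesis using w[of "v a"] by simp
    qed
    have low: "norm e \<le> C * norm (v e)" for e
      using lipschitz_onD[OF C, of "v e" "v 0"] wv[of 0] rangeI[of v 0]
      by (simp add: wv dist_norm linear_0[OF v_linear])
    obtain \<zeta> where \<zeta>: "weakly_tendsto x \<zeta>"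
      using weakly_tendsto_of_image[OF v_linear low] z weak unfolding U_def D_def by blast
    \<comment> \<open>The residuals belong to the points \<open>y k\<close>, so the weak limit of
      \<open>x\<close> must be transferred to \<open>y\<close> before \<open>cluster\<close> places
      it in \<open>S\<close>.\<close>
    have yx: "(\<lambda>k. y k - x k) \<longlonglongrightarrow> 0"
    proof (rule Lim_null_comparison)
      show "\<forall>\<^sub>F k in sequentially. norm (y k - x k) \<le> C * norm (v (y k) - v (x k))"
        using low[of "y k - x k" for k] by (simp add: linear_diff[OF v_linear])
      show "(\<lambda>k. C * norm (v (y k) - v (x k))) \<longlonglongrightarrow> 0"
        using tendsto_mult_right_zero[OF res] by simp
    qed
    have "(\<lambda>k. inner (y k) h) \<longlonglongrightarrow> inner \<zeta> h" for h
    proof -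
      have "(\<lambda>k. inner (x k) h) \<longlonglongrightarrow> inner \<zeta> h"
        using \<zeta> by (simp add: weakly_tendsto_def)
      moreover have "(\<lambda>k. inner (y k - x k) h) \<longlonglongrightarrow> inner 0 h"
        by (intro tendsto_intros yx)
      ultimately have "(\<lambda>k. inner (x k) h + inner (y k - x k) h) \<longlonglongrightarrow> inner \<zeta> h + inner 0 h"
        by (rule tendsto_add)
      then show ?thesis by (simp add: inner_diff_left)
    qed
    then have "weak_cluster_point y \<zeta>"
      unfolding weak_cluster_point_def weakly_tendsto_def
      by (intro exI[of _ "\<lambda>k. k"]) (auto simp: strict_mono_def)
    then show ?thesis using cluster cl \<zeta> by blast
  qed

  \<comment> \<open>Distance to the solution set under R-continuity\<close>
  moreover have "(\<lambda>k. infdist (y k) S) \<longlonglongrightarrow> 0"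
    if R: "R_continuous_at (inv_op (sum_op (single_op A) B)) 0"
  proof -
    have S: "inv_op (sum_op (single_op A) B) 0 = S" by (simp add: S_eq inv_op_def)
    obtain \<sigma> \<rho> where \<sigma>: "0 < \<sigma>" and \<rho>: "(\<rho> \<longlongrightarrow> 0) (at_right 0)" "\<rho> 0 = (0::real)"
      and near: "\<And>d a. d \<in> cball 0 \<sigma> \<Longrightarrow> a \<in> inv_op (sum_op (single_op A) B) d \<Longrightarrow>
        \<exists>t\<in>S. norm (a - t) \<le> \<rho> (norm (d - 0))"
      using R unfolding R_continuous_at_def S by blast
    \<comment> \<open>\<open>norm (c k)\<close> may be 0, a point that the limit at the right of 0
      ignores; \<open>\<rho> 0 = 0\<close> covers it.\<close>
    have "continuous (at 0 within {0..}) \<rho>"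
      using \<rho> by (simp add: continuous_within at_within_Ici_at_right)
    then have "(\<lambda>k. \<rho> (norm (c k))) \<longlonglongrightarrow> \<rho> 0"
      by (rule continuous_within_tendsto_compose') (use tendsto_norm_zero[OF c_lim] in auto)
    then have lim: "(\<lambda>k. \<rho> (norm (c k))) \<longlonglongrightarrow> 0" using \<rho>(2) by simp
    have "\<forall>\<^sub>F k in sequentially. norm (c k) < \<sigma>"
      by (rule order_tendstoD(2)[OF tendsto_norm_zero[OF c_lim] \<sigma>])
    then have "\<forall>\<^sub>F k in sequentially. norm (infdist (y k) S) \<le> \<rho> (norm (c k))"
    proof eventually_elim
      case (elim k)
      obtain t where "t \<in> S" "norm (y k - t) \<le> \<rho> (norm (c k))"
        using near[of "c k" "y k"] elim c_mem[of k] by (auto simp: inv_op_def)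
      then show ?case
        using infdist_le2[of t S "y k"] by (simp add: dist_norm infdist_nonneg)
    qed
    then show ?thesis using lim by (rule Lim_null_comparison)
  qed
  ultimately show ?thesis using res by blast
qed

end
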